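(* Let $A\in\mathbb{C}^{n\times n}$, and suppose that $$A U_m = U_m \widehat H_m + \widehat u_{m+1} c_m^{\mathsf H}\quad\text{and}\quad U_m^{\mathsf H}\widehat u_{m+1}=0,$$ where $U_m\in\mathbb{C}^{n\times m}$ has full (column) rank (its columns need not be orthonormal), $\widehat H_m\in\mathbb{C}^{m\times m}$, $\widehat u_{m+1}\in\mathbb{C}^n$, and $c_m\in\mathbb{C}^m$ is a general vector. Let $\widehat Q_m\in\mathbb{C}^{n\times m}$ be a matrix whose columns form an orthonormal basis of $\mathsf{range}(U_m)$. Then $\widehat H_m$ and $\widehat G_m:=\widehat Q_m^{\mathsf H}A\widehat Q_m$ are similar. Moreover, $$A\widehat Q_m=\widehat Q_m\widehat G_m+\widehat u_{m+1}\widehat c_m^{\mathsf H},\quad\text{where}\quad \widehat c_m=(\widehat Q_m^{\mathsf H}U_m)^{-\mathsf H}c_m,\quad\text{and}\quad \widehat Q_m^{\mathsf H}\widehat u_{m+1}=0.$$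
   Context: $(\cdot)^{\mathsf H}$ denotes the conjugate transpose, $(\cdot)^{-\mathsf H}$ denotes the inverse of the conjugate transpose, and $\mathsf{range}(\cdot)$ denotes the column space of a matrix. *)

theory Defs
  imports
    "Jordan_Normal_Form.Schur_Decomposition"
    "Jordan_Normal_Form.Gauss_Jordan_Elimination"
    "Jordan_Normal_Form.DL_Rank"
begin

(* u v\<^sup>H, the n-by-m product of the column u and the row v\<^sup>H *)
definition outer_adjoint :: "complex vec \<Rightarrow> complex vec \<Rightarrow> complex mat" where
  "outer_adjoint u v = mat (dim_vec u) (dim_vec v) (\<lambda>(i, j). u $ i * cnj (v $ j))"

(* Meaningful only if the adjoint of M is invertible, since mat_inverse returns an option. *)
definition mat_inverse_adjoint :: "complex mat \<Rightarrow> complex mat" where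
  "mat_inverse_adjoint M = the (mat_inverse (mat_adjoint M))"

(* The inner product is conjugate-linear in the second argument: v \<bullet>c w = w\<^sup>H v. *)
definition orthonormal :: "complex vec list \<Rightarrow> bool" where
  "orthonormal vs \<longleftrightarrow>
     (\<forall>i < length vs. \<forall>j < length vs. vs ! i \<bullet>c vs ! j = (if i = j then 1 else 0))"

(* S is meant to be a subspace of carrier_vec n. Lists rather than sets of vectors, so that
   repeated columns of a matrix are not identified; orthonormality rules out repetitions. *)
definition orthonormal_basis :: "nat \<Rightarrow> complex vec list \<Rightarrow> complex vec set \<Rightarrow> bool" where
  "orthonormal_basis n vs S \<longleftrightarrow>
     set vs \<subseteq> carrier_vec n \<and>
     \<not> module.lin_dep class_ring (module_vec TYPE(complex) n) (set vs) \<and>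
     LinearCombinations.module.span class_ring (module_vec TYPE(complex) n) (set vs) = S \<and>
     orthonormal vs"

end

theory Submission
  imports Defs
begin

text \<open>
  Equal column spaces give matrices \<open>R\<close> and \<open>S\<close> with \<open>U = Q R\<close> and \<open>Q = U S\<close>. Since
  \<open>Q\<^sup>H Q = 1\<close>, we get \<open>R = Q\<^sup>H U\<close> and \<open>R S = Q\<^sup>H Q = 1\<close>, so \<open>S\<close> is the inverse of \<open>R\<close>, and
  \<open>Q\<^sup>H u = S\<^sup>H U\<^sup>H u = 0\<close>. Multiplying \<open>A U = U H + u c\<^sup>H\<close> by \<open>S\<close> on the right gives
  \<open>A Q = Q (R H S) + u (S\<^sup>H c)\<^sup>H\<close>, and a further multiplication by \<open>Q\<^sup>H\<close> on the left
  identifies \<open>R H S\<close> with \<open>G\<close>.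
\<close>

lemma dim_mat_adjoint [simp]:
  "dim_row (mat_adjoint A) = dim_col A" "dim_col (mat_adjoint A) = dim_row A"
  by (simp_all add: mat_adjoint_def)

lemma mat_adjoint_carrier [simp]:
  "A \<in> carrier_mat n m \<Longrightarrow> mat_adjoint A \<in> carrier_mat m n"
  by (auto intro!: carrier_matI)

lemma index_mat_adjoint [simp]:
  fixes A :: "complex mat"
  assumes "i < dim_col A" "j < dim_row A"
  shows "mat_adjoint A $$ (i, j) = cnj (A $$ (j, i))"
  using assms by (simp add: mat_adjoint_def mat_of_rows_index)

lemma mat_adjoint_mult:
  fixes A B :: "complex mat"
  assumes "A \<in> carrier_mat n m" "B \<in> carrier_mat m k"
  shows "mat_adjoint (A * B) = mat_adjoint B * mat_adjoint A"
proof (rule eq_matI, goal_cases)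
  case (1 i j)
  with assms show ?case
    by (auto simp: scalar_prod_def mult.commute intro!: sum.cong)
qed (use assms in auto)

lemma mat_adjoint_one [simp]: "mat_adjoint (1\<^sub>m n :: complex mat) = 1\<^sub>m n"
  by (rule eq_matI) auto

lemma outer_adjoint_carrier [simp]:
  "u \<in> carrier_vec n \<Longrightarrow> v \<in> carrier_vec m \<Longrightarrow> outer_adjoint u v \<in> carrier_mat n m"
  by (auto simp: outer_adjoint_def)

lemma outer_adjoint_mult_right:
  assumes "u \<in> carrier_vec n" "v \<in> carrier_vec m" "M \<in> carrier_mat m k"
  shows "outer_adjoint u v * M = outer_adjoint u (mat_adjoint M *\<^sub>v v)"
  by (rule eq_matI)
    (use assms in \<open>auto simp: outer_adjoint_def scalar_prod_def sum_distrib_left mult_ac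
       intro!: sum.cong\<close>)

lemma outer_adjoint_mult_left:
  assumes "M \<in> carrier_mat k n" "u \<in> carrier_vec n" "v \<in> carrier_vec m"
  shows "M * outer_adjoint u v = outer_adjoint (M *\<^sub>v u) v"
  by (rule eq_matI)
    (use assms in \<open>auto simp: outer_adjoint_def scalar_prod_def sum_distrib_left sum_distrib_right mult_ac
       intro!: sum.cong\<close>)

lemma outer_adjoint_zero_left:
  "v \<in> carrier_vec m \<Longrightarrow> outer_adjoint (0\<^sub>v n) v = 0\<^sub>m n m"
  by (rule eq_matI) (auto simp: outer_adjoint_def)

text \<open>The product is the Gram matrix of the columns. Its (i, j) entry is
  \<open>col Q j \<bullet>c col Q i\<close>, with the indices swapped; this is harmless because
  orthonormality ranges over all pairs and the Kronecker delta is symmetric.\<close>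

lemma orthonormal_cols_iff:
  "orthonormal (cols Q) \<longleftrightarrow> mat_adjoint Q * Q = 1\<^sub>m (dim_col Q)"
proof -
  have "(mat_adjoint Q * Q) $$ (i, j) = col Q j \<bullet>c col Q i"
    if "i < dim_col Q" "j < dim_col Q" for i j
    using that by (auto simp: scalar_prod_def mult.commute intro!: sum.cong)
  then show ?thesis
    by (auto simp: orthonormal_def mat_eq_iff)
qed

text \<open>Each column of \<open>B\<close> lies in the column space of \<open>A\<close>, so it is
  the image under \<open>A\<close> of some coefficient vector; these vectors are the columns of
  \<open>X\<close>.\<close>

lemma factor_through_col_space:
  fixes A B :: "complex mat"
  assumes A: "A \<in> carrier_mat n m" and B: "B \<in> carrier_mat n k"
    and sub: "vec_space.col_space n B \<subseteq> vec_space.col_space n A"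
  obtains X where "X \<in> carrier_mat m k" "B = A * X"
proof -
  interpret vec_space "TYPE(complex)" n .
  have "\<exists>x \<in> carrier_vec m. A *\<^sub>v x = col B j" if "j < k" for j
  proof -
    have "col B j \<in> col_space B"
      unfolding col_space_def using B that
      by (metis carrier_matD cols_dim cols_length cols_nth nth_mem span_mem)
    then show ?thesis
      using sub col_space_eq[OF A] A by auto
  qed
  then obtain x where x: "\<And>j. j < k \<Longrightarrow> x j \<in> carrier_vec m"
    "\<And>j. j < k \<Longrightarrow> A *\<^sub>v x j = col B j"
    by metis
  define X where "X = mat_of_cols m (map x [0..<k])"
  have X: "X \<in> carrier_mat m k"
    unfolding X_def using mat_of_cols_carrier(1)[of m "map x [0..<k]"] by simp
  have colX: "col X j = x j" if "j < k" for j
    unfolding X_def using that x by (subst col_mat_of_cols) auto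
  have "B = A * X"
  proof (rule mat_col_eqI)
    fix j assume "j < dim_col (A * X)"
    then have j: "j < k" using X by simp
    show "col B j = col (A * X) j"
      unfolding col_mult2[OF A X j] colX[OF j] x(2)[OF j] ..
  qed (use A B X in auto)
  with X show thesis by (rule that)
qed

text \<open>Evaluates the option hidden in \<open>mat_inverse_adjoint\<close>: for square matrices
  over a field a right inverse is two-sided, and two-sided inverses are unique.\<close>

lemma mat_inverse_eqI:
  fixes M N :: "'a :: field mat"
  assumes M: "M \<in> carrier_mat n n" and N: "N \<in> carrier_mat n n" and MN: "M * N = 1\<^sub>m n"
  shows "mat_inverse M = Some N"
proof -
  have NM: "N * M = 1\<^sub>m n"
    using mat_mult_left_right_inverse[OF M N MN] .
  \<comment> \<open>The specification of \<open>mat_inverse\<close> allows \<open>None\<close> only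
    for non-units of the matrix ring.\<close>
  have "M \<in> Units (ring_mat TYPE('a) n ())"
    using M N MN NM unfolding Units_def ring_mat_def by auto
  then have "mat_inverse M \<noteq> None"
    using mat_inverse(1)[OF M, of "()"] by blast
  then obtain N' where N': "mat_inverse M = Some N'"
    by blast
  have MN': "M * N' = 1\<^sub>m n" and N'_carrier: "N' \<in> carrier_mat n n"
    using mat_inverse(2)[OF M N'] by auto
  have "N' = N * M * N'"
    using N'_carrier by (simp add: NM)
  also have "\<dots> = N"
    using N assoc_mult_mat[OF N M N'_carrier] by (simp add: MN')
  finally have "N' = N" .
  with N' show ?thesis by simp
qed

theorem theorem2p2:
  fixes n m :: nat
    and A U H Q :: "complex mat"
    and u c :: "complex vec"
  assumes "A \<in> carrier_mat n n"
    and "U \<in> carrier_mat n m"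
    and "H \<in> carrier_mat m m"
    and "u \<in> carrier_vec n"
    and "c \<in> carrier_vec m"
    and "A * U = U * H + outer_adjoint u c"
    and "mat_adjoint U *\<^sub>v u = 0\<^sub>v m"
    and "vec_space.rank n U = m"
    and "Q \<in> carrier_mat n m"
    and "orthonormal_basis n (cols Q) (vec_space.col_space n U)"
  shows "let G = mat_adjoint Q * A * Q;
             c' = mat_inverse_adjoint (mat_adjoint Q * U) *\<^sub>v c
         in similar_mat H G
          \<and> A * Q = Q * G + outer_adjoint u c'
          \<and> invertible_mat (mat_adjoint (mat_adjoint Q * U))
          \<and> mat_adjoint Q *\<^sub>v u = 0\<^sub>v m"
proof -
  note A = assms(1) and U = assms(2) and H = assms(3) and u = assms(4) and c = assms(5)
    and AU = assms(6) and Uu = assms(7) and Q = assms(9)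
  interpret vec_space "TYPE(complex)" n .
  define R where "R = mat_adjoint Q * U"
  define G where "G = mat_adjoint Q * A * Q"
  have QU: "col_space Q = col_space U" and QQ: "mat_adjoint Q * Q = 1\<^sub>m m"
    using assms(10) Q orthonormal_cols_iff[of Q]
    unfolding orthonormal_basis_def col_space_def by auto
  obtain S where S: "S \<in> carrier_mat m m" and QS: "Q = U * S"
    using factor_through_col_space[OF U Q] QU by auto
  \<comment> \<open>\<open>X\<close> is provisional: multiplying by the adjoint of \<open>Q\<close>
    on the left shows that it equals \<open>R\<close>.\<close>
  obtain X where X: "X \<in> carrier_mat m m" and UX: "U = Q * X"
    using factor_through_col_space[OF Q U] QU by auto
  have Qa: "mat_adjoint Q \<in> carrier_mat m n" and Sa: "mat_adjoint S \<in> carrier_mat m m"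
    using Q S by auto
  have R: "R \<in> carrier_mat m m"
    unfolding R_def using Qa U by auto
  have "R = mat_adjoint Q * (Q * X)"
    unfolding R_def using UX by simp
  also have "\<dots> = X"
    using assoc_mult_mat[OF Qa Q X] QQ X by simp
  finally have UR: "U = Q * R"
    using UX by simp
  have RS: "R * S = 1\<^sub>m m"
    unfolding R_def using assoc_mult_mat[OF Qa U S] QS QQ by simp
  have SR: "S * R = 1\<^sub>m m"
    using mat_mult_left_right_inverse[OF R S RS] .
  \<comment> \<open>Adjoints reverse products, so this order comes from \<open>SR\<close>, and the
    opposite one from \<open>RS\<close>.\<close>
  have inv: "mat_adjoint R * mat_adjoint S = 1\<^sub>m m"
    using mat_adjoint_mult[OF S R] SR by simp
  have inv': "mat_adjoint S * mat_adjoint R = 1\<^sub>m m"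
    using mat_adjoint_mult[OF R S] RS by simp
  have c': "mat_inverse_adjoint R = mat_adjoint S"
    unfolding mat_inverse_adjoint_def using mat_inverse_eqI[OF _ Sa inv] R by simp
  have invertible: "invertible_mat (mat_adjoint R)"
    unfolding invertible_mat_def inverts_mat_def square_mat.simps
    using inv inv' R S by (auto intro!: exI[of _ "mat_adjoint S"])
  have Qu: "mat_adjoint Q *\<^sub>v u = 0\<^sub>v m"
  proof -
    have "mat_adjoint Q *\<^sub>v u = mat_adjoint S *\<^sub>v (mat_adjoint U *\<^sub>v u)"
      using mat_adjoint_mult[OF U S] QS assoc_mult_mat_vec[OF Sa mat_adjoint_carrier[OF U] u]
      by simp
    also have "\<dots> = 0\<^sub>v m"
      unfolding Uu by (rule eq_vecI) (use S in auto)
    finally show ?thesis .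
  qed
  define d where "d = mat_adjoint S *\<^sub>v c"
  have d: "d \<in> carrier_vec m"
    unfolding d_def using Sa c by auto
  have RHS: "R * H * S \<in> carrier_mat m m"
    using R H S by auto
  have "A * Q = A * U * S"
    using QS assoc_mult_mat[OF A U S] by simp
  also have "\<dots> = U * H * S + outer_adjoint u c * S"
    unfolding AU using U H S u c
    by (intro add_mult_distrib_mat[where nr = n and n = m]) auto
  \<comment> \<open>Only the leading \<open>U\<close> is replaced, by \<open>Q * R\<close>; the rest
    is regrouped.\<close>
  also have "U * H * S = Q * (R * H * S)"
    using Q R H S by (simp add: UR assoc_mult_mat[of _ _ m _ m _ m] assoc_mult_mat[of _ n m _ m _ m])
  also have "outer_adjoint u c * S = outer_adjoint u d"
    unfolding d_def by (rule outer_adjoint_mult_right[OF u c S])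
  finally have AQ: "A * Q = Q * (R * H * S) + outer_adjoint u d" .
  have "G = mat_adjoint Q * (A * Q)"
    unfolding G_def by (rule assoc_mult_mat[OF Qa A Q])
  also have "\<dots> = mat_adjoint Q * (Q * (R * H * S)) + mat_adjoint Q * outer_adjoint u d"
    unfolding AQ using Q RHS u d by (intro mult_add_distrib_mat[OF Qa]) auto
  also have "mat_adjoint Q * (Q * (R * H * S)) = R * H * S"
    using assoc_mult_mat[OF Qa Q RHS] unfolding QQ left_mult_one_mat[OF RHS] by (rule sym)
  \<comment> \<open>Orthogonality of \<open>u\<close> to the columns of \<open>Q\<close> removes the
    residual term, leaving exactly \<open>R * H * S\<close>.\<close>
  also have "mat_adjoint Q * outer_adjoint u d = 0\<^sub>m m m"
    using outer_adjoint_mult_left[OF Qa u d] Qu outer_adjoint_zero_left[OF d] by simp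
  finally have G: "G = R * H * S"
    using RHS by simp
  \<comment> \<open>The witness puts \<open>G\<close> first, matching \<open>G = R * H * S\<close>;
    symmetry of similarity then gives the order in the claim.\<close>
  have "similar_mat_wit G H R S"
    using R S H RHS RS SR by (intro similar_mat_witI[of _ _ m]) (auto simp: G)
  then have "similar_mat H G"
    unfolding similar_mat_def using similar_mat_wit_sym by blast
  with AQ invertible Qu show ?thesis
    unfolding Let_def R_def[symmetric] G_def[symmetric] c' d_def[symmetric] G[symmetric] by simp
qed

end
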